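(* Let $N\in\mathbb{N}$, $B\in\mathbb{R}^+$ and set $Q=\prod_{2<r\le B} r$, the product over primes $r$. Assume $\gcd(N,Q)=1$. Then \[ |\mathcal{L}_{N,Q}|\in O\left(\frac{Q\log B}{2^{\pi(B)}}\right), \] where $\pi$ is the prime counting function and the implied constant does not depend on $N$ or $B$.
   Context: For $N,m\in\mathbb{N}$ with $\gcd(N,m)=1$, let $\mathcal{H}_{N,m}:=\{(x,y)\in(\mathbb{Z}/m\mathbb{Z})^2: N\equiv xy \bmod m\}$ and $\mathcal{L}_{N,m}:=\{x+y \bmod m : (x,y)\in\mathcal{H}_{N,m}\}\subseteq\mathbb{Z}/m\mathbb{Z}$. $\pi(x)$ denotes the number of primes $\le x$.
   Formalization: The bound is stated for B ≥ 2 rather than all B > 0, since at B = 1 one has Q = 1 and |L| = 1 while log B = 0, and no uniform constant works for B near 1. *)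

theory Defs
  imports Complex_Main "HOL-Number_Theory.Number_Theory"
begin

text \<open>Elements of \<open>\<int>/m\<int>\<close> are represented by their least residues in \<open>{..<m}\<close>; all uses have \<open>m > 0\<close>.\<close>

definition hyperbola :: "nat \<Rightarrow> nat \<Rightarrow> (nat \<times> nat) set" where
  "hyperbola N m = {(x, y) \<in> {..<m} \<times> {..<m}. [N = x * y] (mod m)}"

definition hyperbola_sums :: "nat \<Rightarrow> nat \<Rightarrow> nat set" where
  "hyperbola_sums N m = (\<lambda>(x, y). (x + y) mod m) ` hyperbola N m"

definition odd_primorial :: "real \<Rightarrow> nat" where
  "odd_primorial B = \<Prod>{r :: nat. prime r \<and> 2 < r \<and> real r \<le> B}"

definition prime_count :: "real \<Rightarrow> nat" where
  "prime_count x = card {p :: nat. prime p \<and> real p \<le> x}"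

end

theory Submission
  imports Defs
begin

text \<open>
  The Chinese remainder theorem bounds the number of sums modulo \<open>Q\<close> by the product of the
  numbers of sums modulo the primes \<open>r\<close> dividing \<open>Q\<close>. Modulo \<open>r\<close> the hyperbola has at most
  \<open>r - 1\<close> points, and it is symmetric with at most two points on the diagonal, so there are at
  most \<open>(r + 1) / 2\<close> sums. It remains to show \<open>\<Prod>(1 + 1/r) = O(ln B)\<close>. With \<open>s = 1 / ln B\<close>,
  the factor \<open>1 + 1/r\<close> is at most \<open>(1 + r powr (-1-s)) * exp (s * ln r / r)\<close>; the product of the
  first factors is at most \<open>\<zeta>(1 + s) \<le> 1 + 1/s\<close>, and that of the second factors is bounded
  because \<open>\<Sum> ln r / r = O(ln B)\<close>, which follows from the factorisation of \<open>n!\<close>.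
\<close>

section \<open>Sums on modular hyperbolas\<close>

lemma finite_hyperbola: "finite (hyperbola N m)"
  by (rule finite_subset[of _ "{..<m} \<times> {..<m}"]) (auto simp: hyperbola_def)

lemma hyperbola_sums_subset: "m > 0 \<Longrightarrow> hyperbola_sums N m \<subseteq> {..<m}"
  by (auto simp: hyperbola_sums_def)

lemma finite_hyperbola_sums: "finite (hyperbola_sums N m)"
  by (simp add: hyperbola_sums_def finite_hyperbola)

section \<open>Reduction from a squarefree modulus to its prime factors\<close>

lemma hyperbola_sums_mod_dvd:
  assumes "s \<in> hyperbola_sums N m" "d dvd m" "d > 0"
  shows "s mod d \<in> hyperbola_sums N d"
proof -
  obtain x y where xy: "[N = x * y] (mod m)" "s = (x + y) mod m"
    using assms(1) by (auto simp: hyperbola_sums_def hyperbola_def)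
  have "[N = x * y] (mod d)"
    using xy(1) assms(2) cong_dvd_modulus_nat by blast
  then have "(x mod d, y mod d) \<in> hyperbola N d"
    using assms(3) by (simp add: hyperbola_def cong_def mod_mult_eq)
  moreover have "s mod d = (x mod d + y mod d) mod d"
    by (simp add: xy(2) mod_mod_cancel[OF assms(2)] mod_add_eq)
  ultimately show ?thesis
    unfolding hyperbola_sums_def by (metis (no_types, lifting) case_prod_conv image_eqI)
qed

text \<open>By the Chinese remainder theorem a sum modulo \<open>m * n\<close> is determined by its
  residues modulo \<open>m\<close> and \<open>n\<close>, and these are again sums on the reduced
  hyperbolas.\<close>

lemma card_hyperbola_sums_mult_le:
  assumes "coprime m n" "m > 0" "n > 0"
  shows "card (hyperbola_sums N (m * n)) \<le> card (hyperbola_sums N m) * card (hyperbola_sums N n)"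
proof -
  have "inj_on (\<lambda>s. (s mod m, s mod n)) (hyperbola_sums N (m * n))"
  proof (rule inj_onI)
    fix s t
    assume st: "s \<in> hyperbola_sums N (m * n)" "t \<in> hyperbola_sums N (m * n)"
      "(s mod m, s mod n) = (t mod m, t mod n)"
    then have "[s = t] (mod m)" "[s = t] (mod n)"
      by (simp_all add: cong_def)
    then have "[s = t] (mod m * n)"
      using assms(1) by (rule coprime_cong_mult_nat)
    moreover have "s < m * n" "t < m * n"
      using hyperbola_sums_subset[of "m * n" N, THEN subsetD] st assms(2,3) by simp_all
    ultimately show "s = t"
      by (simp add: cong_def)
  qed
  moreover have "(\<lambda>s. (s mod m, s mod n)) ` hyperbola_sums N (m * n)
      \<subseteq> hyperbola_sums N m \<times> hyperbola_sums N n"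
    using assms by (auto intro: hyperbola_sums_mod_dvd)
  ultimately have "card (hyperbola_sums N (m * n)) \<le> card (hyperbola_sums N m \<times> hyperbola_sums N n)"
    by (intro card_inj_on_le) (auto simp: finite_hyperbola_sums)
  then show ?thesis
    by (simp add: card_cartesian_product)
qed

lemma card_hyperbola_sums_prod_le:
  assumes "finite P" "\<And>p. p \<in> P \<Longrightarrow> prime p"
  shows "card (hyperbola_sums N (\<Prod>P)) \<le> (\<Prod>p\<in>P. card (hyperbola_sums N p))"
  using assms
proof (induction P rule: finite_induct)
  case empty
  have "card (hyperbola_sums N 1) \<le> card {..<1::nat}"
    by (intro card_mono hyperbola_sums_subset) auto
  then show ?case by simp
next
  case (insert p P)
  have "coprime p (\<Prod>P)"
    using insert by (intro prod_coprime_right) (auto intro: primes_coprime)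
  moreover have "\<Prod>P > 0"
    using insert.prems by (intro prod_pos) (auto intro: prime_gt_0_nat)
  ultimately have "card (hyperbola_sums N (p * \<Prod>P))
      \<le> card (hyperbola_sums N p) * card (hyperbola_sums N (\<Prod>P))"
    using insert.prems by (intro card_hyperbola_sums_mult_le) (auto intro: prime_gt_0_nat)
  also have "\<dots> \<le> card (hyperbola_sums N p) * (\<Prod>p\<in>P. card (hyperbola_sums N p))"
    using insert by simp
  finally show ?case
    using insert.hyps by simp
qed

section \<open>Counting points and sums modulo one prime\<close>

lemma card_hyperbola_le:
  assumes "prime p" "coprime N p"
  shows "card (hyperbola N p) \<le> p - 1"
proof -
  have nz: "\<not> p dvd x" if "(x, y) \<in> hyperbola N p" for x y
  proof
    assume "p dvd x"
    then have "p dvd x * y" by simp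
    moreover have "[N = x * y] (mod p)" using that by (simp add: hyperbola_def)
    ultimately have "p dvd N" using cong_dvd_iff by blast
    then show False
      using assms by (metis coprime_commute not_coprimeI dvd_refl not_prime_unit)
  qed
  \<comment> \<open>The first coordinate is invertible modulo \<open>p\<close>, so it determines the
    second; the count is then bounded by the number of nonzero residues.\<close>
  have "inj_on fst (hyperbola N p)"
  proof (rule inj_onI)
    fix u v
    assume uv: "u \<in> hyperbola N p" "v \<in> hyperbola N p" "fst u = fst v"
    obtain x y z where u: "u = (x, y)" and v: "v = (x, z)"
      using uv(3) by (metis prod.collapse)
    have "[x * y = x * z] (mod p)"
      using uv u v by (auto simp: hyperbola_def cong_def)
    moreover have "coprime x p"
      using nz[of x y] uv u assms(1) by (simp add: coprime_commute prime_imp_coprime)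
    ultimately have "[y = z] (mod p)"
      by (simp add: cong_mult_lcancel_nat)
    then show "u = v"
      using uv u v by (auto simp: hyperbola_def cong_def)
  qed
  moreover have "fst ` hyperbola N p \<subseteq> {1..<p}"
  proof
    fix x assume "x \<in> fst ` hyperbola N p"
    then obtain y where xy: "(x, y) \<in> hyperbola N p" by auto
    have "x \<noteq> 0" using nz[OF xy] by (metis dvd_0_right)
    then show "x \<in> {1..<p}" using xy by (auto simp: hyperbola_def)
  qed
  ultimately have "card (hyperbola N p) \<le> card {1..<p}"
    by (intro card_inj_on_le) auto
  then show ?thesis by simp
qed

text \<open>Diagonal points are square roots of \<open>N\<close> in a field: if \<open>a\<close> is
  one root, any other root \<open>x\<close> satisfies \<open>(x - a) * (x + a) = 0\<close> modulo
  \<open>p\<close>.\<close>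

lemma card_hyperbola_diagonal_le:
  assumes "prime p"
  shows "card {(x, y) \<in> hyperbola N p. x = y} \<le> 2"
proof (cases "{(x, y) \<in> hyperbola N p. x = y} = {}")
  case False
  then obtain a where a: "(a, a) \<in> hyperbola N p" by auto
  have "x = a \<or> x = p - a" if x: "(x, x) \<in> hyperbola N p" for x
  proof -
    have lt: "x < p" "a < p" using x a by (auto simp: hyperbola_def)
    have "[x * x = a * a] (mod p)"
      using x a by (auto simp: hyperbola_def cong_def)
    then have "[int x * int x = int a * int a] (mod int p)"
      by (metis cong_int_iff of_nat_mult)
    then have "int p dvd (int x - int a) * (int x + int a)"
      by (simp add: cong_iff_dvd_diff algebra_simps)
    then have "int p dvd int x - int a \<or> int p dvd int x + int a"
      using assms by (simp add: prime_dvd_mult_iff)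
    then show ?thesis
    proof
      assume "int p dvd int x - int a"
      then have "[int x = int a] (mod int p)" by (simp add: cong_iff_dvd_diff)
      then show ?thesis using lt by (simp add: cong_int_iff cong_def)
    next
      assume "int p dvd int x + int a"
      then have "p dvd x + a" by (metis of_nat_add of_nat_dvd_iff)
      \<comment> \<open>A multiple of \<open>p\<close> below \<open>2 * p\<close> is
        \<open>0\<close> or \<open>p\<close>. The first case forces \<open>x = a = 0\<close>, the
        second gives \<open>x = p - a\<close>.\<close>
      then obtain k where k: "x + a = p * k" by (auto simp: dvd_def)
      moreover have "x + a < p * 2" using lt by simp
      ultimately have "k < 2" by (metis mult_less_cancel1)
      then have "k = 0 \<or> k = 1" by auto
      then show ?thesis using k lt by auto
    qed
  qed
  then have "{(x, y) \<in> hyperbola N p. x = y} \<subseteq> {(a, a), (p - a, p - a)}"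
    by auto
  then have "card {(x, y) \<in> hyperbola N p. x = y} \<le> card {(a, a), (p - a, p - a)}"
    by (intro card_mono) auto
  also have "\<dots> \<le> 2" by (simp add: card_insert_if)
  finally show ?thesis .
next
  case True
  then show ?thesis by (simp only: card.empty)
qed

text \<open>Swapping coordinates preserves both the hyperbola and the sum, so the points with
  \<open>x \<le> y\<close> already yield every sum. Twice their number is
  \<open>card D + card H\<close>, at most \<open>2 + (p - 1)\<close>.\<close>

lemma card_hyperbola_sums_prime_le:
  assumes "prime p" "coprime N p"
  shows "2 * card (hyperbola_sums N p) \<le> p + 1"
proof -
  define H where "H = hyperbola N p"
  define D where "D = {(x, y) \<in> H. x = y}"
  define U where "U = {(x, y) \<in> H. x < y}"
  define f where "f = (\<lambda>(x, y). (x + y) mod p)"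
  have fin: "finite H" "finite D" "finite U"
    using finite_hyperbola[of N p]
    by (auto simp: H_def D_def U_def elim!: rev_finite_subset)
  have sym: "(y, x) \<in> H" if "(x, y) \<in> H" for x y
    using that by (auto simp: H_def hyperbola_def mult.commute)
  have H: "H = D \<union> U \<union> prod.swap ` U"
    by (fastforce simp: D_def U_def image_iff intro: sym)
  have "card H = card (D \<union> U) + card (prod.swap ` U)"
    unfolding H using fin by (intro card_Un_disjoint) (auto simp: D_def U_def)
  also have "card (D \<union> U) = card D + card U"
    using fin by (intro card_Un_disjoint) (auto simp: D_def U_def)
  also have "card (prod.swap ` U) = card U"
    by (intro card_image) auto
  finally have cH: "card H = card D + 2 * card U" by simp
  have "hyperbola_sums N p = f ` H"
    by (simp add: hyperbola_sums_def f_def H_def)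
  also have "\<dots> = f ` (D \<union> U)"
    unfolding H by (simp add: image_Un image_image f_def case_prod_beta add.commute)
  finally have "card (hyperbola_sums N p) \<le> card (D \<union> U)"
    using fin by (simp add: card_image_le)
  also have "\<dots> \<le> card D + card U" by (rule card_Un_le)
  finally have "2 * card (hyperbola_sums N p) \<le> card D + card H"
    using cH by simp
  moreover have "card D \<le> 2"
    using card_hyperbola_diagonal_le[OF assms(1)] by (simp add: D_def H_def)
  moreover have "card H \<le> p - 1"
    using card_hyperbola_le[OF assms] by (simp add: H_def)
  moreover have "p > 0" using assms(1) by (rule prime_gt_0_nat)
  ultimately show ?thesis by linarith
qed

section \<open>Products over primes\<close>

lemma prime_power_dvd_fact:
  fixes p :: nat
  assumes "p > 0"
  shows "p ^ k dvd fact (p * k)"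
proof (induction k)
  case (Suc k)
  \<comment> \<open>Splitting off the top factor \<open>p * Suc k\<close> of the factorial gains one
    \<open>p\<close>; the rest, \<open>fact q\<close>, is still divisible by
    \<open>fact (p * k)\<close>.\<close>
  obtain q where q: "p * Suc k = Suc q" using assms by (metis gr0_conv_Suc mult_pos_pos zero_less_Suc)
  then have "p * k \<le> q" using assms by simp
  then have "p ^ k dvd fact q" using Suc by (meson dvd_trans fact_dvd)
  then have "p * p ^ k dvd (p * Suc k) * fact q" by (intro mult_dvd_mono) auto
  then show ?case unfolding q by simp
qed simp

text \<open>The \<open>n div p\<close> multiples of \<open>p\<close> up to \<open>n\<close> each
  contribute a factor \<open>p\<close> to \<open>n!\<close>, and powers of distinct primes are
  coprime, so their product divides \<open>n!\<close>.\<close>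

lemma prod_primes_power_div_le_fact:
  fixes P :: "nat set"
  assumes "finite P" "\<And>p. p \<in> P \<Longrightarrow> prime p"
  shows "(\<Prod>p\<in>P. p ^ (n div p)) \<le> fact n"
proof -
  have "(\<Prod>p\<in>P. p ^ (n div p)) dvd fact n"
    using assms
  proof (induction P rule: finite_induct)
    case (insert p P)
    have "p ^ (n div p) dvd fact (p * (n div p))"
      using insert.prems by (intro prime_power_dvd_fact) (auto intro: prime_gt_0_nat)
    also have "\<dots> dvd (fact n :: nat)"
      by (intro fact_dvd) simp
    finally have "p ^ (n div p) dvd fact n" .
    moreover have "coprime (p ^ (n div p)) (\<Prod>p\<in>P. p ^ (n div p))"
      using insert by (intro prod_coprime_right coprime_power_left_iff[THEN iffD2] disjI1
          coprime_power_right_iff[THEN iffD2]) (metis insertCI primes_coprime)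
    ultimately show ?case
      using insert by (simp add: divides_mult)
  qed simp
  then show ?thesis by (intro dvd_imp_le) auto
qed

lemma sum_ln_prime_div_le:
  fixes P :: "nat set"
  assumes P: "P \<subseteq> {p. prime p \<and> p \<le> n}" and n: "n > 0"
  shows "(\<Sum>p\<in>P. ln p / p) \<le> 2 * ln (real n)"
proof -
  have fin: "finite P" by (rule finite_subset[of _ "{..n}"]) (use P in auto)
  have pr: "prime p" "p \<le> n" "p > 0" if "p \<in> P" for p
    using P that by (auto intro: prime_gt_0_nat)
  have "n / 2 * (\<Sum>p\<in>P. ln p / p) = (\<Sum>p\<in>P. n / (2 * p) * ln p)"
    by (simp add: sum_distrib_left field_simps)
  also have "\<dots> \<le> (\<Sum>p\<in>P. real (n div p) * ln p)"
  proof (intro sum_mono mult_right_mono)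
    \<comment> \<open>Since \<open>p \<le> n\<close>, the quotient \<open>n div p\<close> is at
      least 1, hence \<open>n / p < n div p + 1 \<le> 2 * (n div p)\<close>. This is the source of
      the factor 2.\<close>
    fix p assume p: "p \<in> P"
    have "n < p * (n div p) + p"
      using pr(3)[OF p] by (metis add_strict_left_mono mod_less_divisor mult_div_mod_eq)
    moreover have "1 \<le> n div p"
      using pr[OF p] by (simp add: Suc_leI div_greater_zero_iff)
    then have "p * 1 \<le> p * (n div p)" by (intro mult_left_mono) auto
    ultimately have "n \<le> 2 * (p * (n div p))" by linarith
    then have "real n \<le> 2 * (real p * real (n div p))"
      by (metis of_nat_le_iff of_nat_mult of_nat_numeral)
    then show "n / (2 * p) \<le> real (n div p)"
      using pr(3)[OF p] by (simp add: field_simps)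
    show "0 \<le> ln (real p)" using pr(3)[OF p] by simp
  qed
  also have "\<dots> = (\<Sum>p\<in>P. ln (real (p ^ (n div p))))"
    by (intro sum.cong refl) (use pr in \<open>simp add: ln_realpow\<close>)
  also have "\<dots> = ln (\<Prod>p\<in>P. real (p ^ (n div p)))"
    using pr fin by (subst ln_prod) auto
  also have "\<dots> \<le> ln (fact n)"
  proof -
    have "real (\<Prod>p\<in>P. p ^ (n div p)) \<le> real (fact n)"
      using prod_primes_power_div_le_fact[OF fin pr(1)] of_nat_mono by blast
    moreover have "0 < (\<Prod>p\<in>P. real (p ^ (n div p)))"
      using pr by (intro prod_pos) simp
    ultimately show ?thesis by (subst ln_le_cancel_iff) auto
  qed
  also have "\<dots> \<le> ln (real n ^ n)"
    using n fact_le_power[of n, where 'a = real] by (subst ln_le_cancel_iff) auto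
  also have "\<dots> = n * ln n" using n by (simp add: ln_realpow)
  finally show ?thesis using n by (simp add: field_simps)
qed

section \<open>Rankin's trick: partial sums of zeta and a truncated Euler product\<close>

lemma sum_powr_le:
  fixes s :: real
  assumes s: "s > 0"
  shows "(\<Sum>k=1..n. real k powr (-1 - s)) \<le> 1 + 1 / s"
proof -
  \<comment> \<open>The subtracted tail, an antiderivative value as in the integral test, makes the
    induction telescope; at \<open>m = 0\<close> equality holds.\<close>
  have "(\<Sum>k=1..Suc m. real k powr (-1 - s)) \<le> 1 + 1 / s - real (Suc m) powr - s / s" for m
  proof (induction m)
    case (Suc m)
    define x where "x = real (Suc (Suc m))"
    have x: "x \<ge> 2" "real (Suc m) = x * (1 - 1 / x)" by (auto simp: x_def field_simps)
    \<comment> \<open>The telescoping step amounts to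
      \<open>1 + s / x \<le> (1 - 1 / x) powr - s\<close>, obtained from the tangent-line bounds for
      \<open>ln\<close> and \<open>exp\<close>.\<close>
    have "ln (1 - 1 / x) \<le> - (1 / x)"
      using x(1) ln_le_minus_one[of "1 - 1 / x"] by simp
    then have "1 + s * (1 / x) \<le> 1 + (- s) * ln (1 - 1 / x)"
      using s mult_left_mono[of "ln (1 - 1 / x)" "- (1 / x)" s] by simp
    also have "\<dots> \<le> exp (- s * ln (1 - 1 / x))" by (rule exp_ge_add_one_self)
    also have "\<dots> = (1 - 1 / x) powr - s" using x(1) by (simp add: powr_def)
    finally have "x powr - s * (1 + s * (1 / x)) \<le> x powr - s * (1 - 1 / x) powr - s"
      by (intro mult_left_mono) auto
    also have "\<dots> = real (Suc m) powr - s"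
      unfolding x(2) using x(1) by (subst powr_mult) auto
    finally have "x powr - s + s * (x powr - s / x) \<le> real (Suc m) powr - s"
      by (simp add: algebra_simps)
    moreover have "x powr - s / x = x powr (-1 - s)"
      using x(1) by (simp add: powr_diff powr_minus field_simps)
    ultimately have "x powr (-1 - s) \<le> real (Suc m) powr - s / s - x powr - s / s"
      using s by (simp add: field_simps)
    then show ?case using Suc by (simp add: x_def)
  qed (use s in simp)
  moreover have "0 \<le> real (Suc m) powr - s / s" for m using s by simp
  ultimately have *: "(\<Sum>k=1..Suc m. real k powr (-1 - s)) \<le> 1 + 1 / s" for m
    by (smt (verit))
  show ?thesis
  proof (cases n)
    case 0
    then show ?thesis using s by simp
  qed (use * in simp)
qed

text \<open>Expanding the product gives one term for each subset of \<open>P\<close>. By unique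
  factorisation the subset products are distinct integers between 1 and the product of
  \<open>P\<close>.\<close>

lemma prod_primes_powr_le_sum:
  fixes P :: "nat set"
  assumes "finite P" "\<And>p. p \<in> P \<Longrightarrow> prime p"
  shows "(\<Prod>p\<in>P. 1 + real p powr a) \<le> (\<Sum>k=1..\<Prod>P. real k powr a)"
proof -
  have inj: "inj_on (\<lambda>X. \<Prod>X) (Pow P)"
  proof (rule inj_on_inverseI)
    fix X assume X: "X \<in> Pow P"
    then have "finite X" using assms(1) finite_subset by auto
    then have "p dvd \<Prod>X \<longleftrightarrow> p \<in> X" if "p \<in> P" for p
      using X assms(2) that
      by (metis PowD dvd_prodI prime_dvd_prod_iff primes_dvd_imp_eq subsetD)
    then show "{p \<in> P. p dvd \<Prod>X} = X" using X by auto
  qed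
  have pos: "0 < \<Prod>X" if "X \<subseteq> P" for X
    using that assms(2) by (intro prod_pos) (meson prime_gt_0_nat subsetD)
  have "(\<Prod>p\<in>P. 1 + real p powr a) = (\<Sum>X\<in>Pow P. (\<Prod>p\<in>P - X. real p powr a))"
    using assms(1) by (subst prod_add) auto
  also have "\<dots> = (\<Sum>X\<in>Pow P. (\<Prod>p\<in>X. real p powr a))"
    by (rule sum.reindex_bij_witness[of _ "\<lambda>X. P - X" "\<lambda>X. P - X"]) (auto simp: double_diff)
  also have "\<dots> = (\<Sum>X\<in>Pow P. real (\<Prod>X) powr a)"
    by (intro sum.cong refl) (simp add: prod_powr_distrib)
  also have "\<dots> = (\<Sum>k\<in>(\<lambda>X. \<Prod>X) ` Pow P. real k powr a)"
    using inj by (simp add: sum.reindex)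
  also have "\<dots> \<le> (\<Sum>k=1..\<Prod>P. real k powr a)"
  proof (intro sum_mono2)
    show "(\<lambda>X. \<Prod>X) ` Pow P \<subseteq> {1..\<Prod>P}"
    proof clarsimp
      fix X assume X: "X \<subseteq> P"
      then have "\<Prod>X dvd \<Prod>P" using assms(1) by (intro prod_dvd_prod_subset)
      then show "Suc 0 \<le> \<Prod>X \<and> \<Prod>X \<le> \<Prod>P"
        using pos[OF X] pos[of P] by (auto intro: dvd_imp_le simp: Suc_le_eq)
    qed
  qed auto
  finally show ?thesis .
qed

lemma prod_one_plus_inverse_prime_le:
  fixes P :: "nat set" and B :: real
  assumes P: "P \<subseteq> {p. prime p \<and> real p \<le> B}" and B: "B \<ge> 2"
  shows "(\<Prod>p\<in>P. 1 + 1 / real p) \<le> (1 + ln B) * exp 2"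
proof -
  \<comment> \<open>This choice balances the two factors: the zeta bound \<open>1 + 1 / s\<close>
    becomes \<open>1 + ln B\<close>, while \<open>s\<close> times the sum of \<open>ln p / p\<close>
    stays at most 2.\<close>
  define s where "s = 1 / ln B"
  have lnB: "ln B > 0" using B by simp
  then have s: "s > 0" by (simp add: s_def)
  define n where "n = nat \<lfloor>B\<rfloor>"
  have n: "n > 0" "real n \<le> B" using B by (auto simp: n_def le_nat_floor)
  have Pn: "P \<subseteq> {p. prime p \<and> p \<le> n}" using P by (auto simp: n_def le_nat_floor)
  then have fin: "finite P" by (auto intro: finite_subset[of _ "{..n}"])
  have pr: "prime p" "p > 0" if "p \<in> P" for p using P that by (auto intro: prime_gt_0_nat)
  have "(\<Prod>p\<in>P. 1 + 1 / real p) \<le> (\<Prod>p\<in>P. (1 + real p powr (-1 - s)) * exp (s * (ln p / p)))"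
  proof (intro prod_mono conjI)
    fix p assume p: "p \<in> P"
    have pp: "p > 0" by (rule pr(2)[OF p])
    \<comment> \<open>Replacing \<open>1 / p\<close> by \<open>p powr (-1 - s)\<close> costs at most
      \<open>s * ln p / p\<close>.\<close>
    have "1 - s * ln p \<le> exp (- (s * ln p))" using exp_ge_add_one_self[of "- (s * ln p)"] by simp
    also have "\<dots> = real p powr - s" using pp by (simp add: powr_def)
    finally have "(1 - s * ln p) / p \<le> real p powr - s / p"
      by (intro divide_right_mono) auto
    then have "1 / p - s * (ln p / p) \<le> real p powr - s / p"
      by (simp add: diff_divide_distrib)
    also have "\<dots> = real p powr (-1 - s)"
      using pp by (simp add: powr_diff powr_minus field_simps)
    finally have 1: "1 / p \<le> real p powr (-1 - s) + s * (ln p / p)" by simp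
    have t: "0 \<le> s * (ln p / p)" using s pp by simp
    have "1 + 1 / p \<le> 1 + real p powr (-1 - s) + s * (ln p / p)" using 1 by simp
    also have "\<dots> \<le> (1 + real p powr (-1 - s)) * (1 + s * (ln p / p))"
      using mult_nonneg_nonneg[OF powr_ge_zero t, of p "-1 - s"]
      by (simp only: distrib_left distrib_right mult_1_left mult_1_right)
    also have "\<dots> \<le> (1 + real p powr (-1 - s)) * exp (s * (ln p / p))"
      by (intro mult_left_mono exp_ge_add_one_self) (simp add: add_nonneg_nonneg)
    finally show "1 + 1 / p \<le> (1 + real p powr (-1 - s)) * exp (s * (ln p / p))" .
  qed simp
  also have "\<dots> = (\<Prod>p\<in>P. 1 + real p powr (-1 - s)) * exp (s * (\<Sum>p\<in>P. ln p / p))"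
    using fin by (simp add: prod.distrib exp_sum sum_distrib_left)
  also have "\<dots> \<le> (1 + 1 / s) * exp 2"
  proof (intro mult_mono)
    show "(\<Prod>p\<in>P. 1 + real p powr (-1 - s)) \<le> 1 + 1 / s"
      using prod_primes_powr_le_sum[OF fin pr(1)] sum_powr_le[OF s] by (rule order_trans)
    have "(\<Sum>p\<in>P. ln p / p) \<le> 2 * ln n" by (rule sum_ln_prime_div_le[OF Pn n(1)])
    also have "\<dots> \<le> 2 * ln B" using n by simp
    finally have "s * (\<Sum>p\<in>P. ln p / p) \<le> s * (2 * ln B)" using s by (intro mult_left_mono) auto
    also have "\<dots> = 2" using lnB by (simp add: s_def)
    finally show "exp (s * (\<Sum>p\<in>P. ln p / p)) \<le> exp 2" by simp
  qed (use s in auto)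
  also have "1 + 1 / s = 1 + ln B" by (simp add: s_def)
  finally show ?thesis .
qed

text \<open>The range \<open>B \<ge> 2\<close> keeps \<open>ln B\<close> away from 0: at
  \<open>B = 1\<close> the modulus is 1 and there is one sum, but the right side vanishes.\<close>

theorem theorem5p5:
  "\<exists>C > 0. \<forall>(N :: nat) (B :: real). B \<ge> 2 \<longrightarrow> coprime N (odd_primorial B) \<longrightarrow>
     real (card (hyperbola_sums N (odd_primorial B)))
       \<le> C * (real (odd_primorial B) * ln B / 2 ^ prime_count B)"
proof -
  \<comment> \<open>The leading 2 pays for the prime 2, which \<open>prime_count\<close> counts but
    \<open>odd_primorial\<close> omits; \<open>1 / ln 2 + 1\<close> absorbs the summand 1 of
    \<open>1 + ln B\<close>; \<open>exp 2\<close> comes from the product bound.\<close>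
  define C where "C = 2 * ((1 / ln 2 + 1) * exp (2::real))"
  have "C > 0" by (simp add: C_def add_pos_pos)
  moreover have "real (card (hyperbola_sums N (odd_primorial B)))
       \<le> C * (real (odd_primorial B) * ln B / 2 ^ prime_count B)"
    if B: "B \<ge> 2" and cop: "coprime N (odd_primorial B)" for N :: nat and B :: real
  proof -
    define P where "P = {r :: nat. prime r \<and> 2 < r \<and> real r \<le> B}"
    have Q: "odd_primorial B = \<Prod>P" by (simp add: odd_primorial_def P_def)
    have fin: "finite P"
      by (rule finite_subset[of _ "{..nat \<lfloor>B\<rfloor>}"]) (auto simp: P_def le_nat_floor)
    have pr: "prime p" if "p \<in> P" for p using that by (simp add: P_def)
    have "{p :: nat. prime p \<and> real p \<le> B} = insert 2 P"
      using B by (auto simp: P_def dest: prime_ge_2_nat)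
    then have \<pi>: "prime_count B = Suc (card P)"
      using fin by (simp add: prime_count_def P_def)
    have "real (card (hyperbola_sums N (\<Prod>P))) \<le> (\<Prod>p\<in>P. real (card (hyperbola_sums N p)))"
      using card_hyperbola_sums_prod_le[OF fin pr] by (metis of_nat_le_iff of_nat_prod)
    \<comment> \<open>Writing \<open>(p + 1) / 2\<close> in this form separates the modulus, the
      power of 2 and the Mertens product.\<close>
    also have "\<dots> \<le> (\<Prod>p\<in>P. real p * (1 + 1 / real p) / 2)"
    proof (intro prod_mono conjI)
      fix p assume p: "p \<in> P"
      have "p dvd \<Prod>P" using fin p by (rule dvd_prodI)
      then have "coprime N p" using cop Q by (metis coprime_divisors dvd_refl)
      then have "2 * card (hyperbola_sums N p) \<le> p + 1"
        by (intro card_hyperbola_sums_prime_le pr p)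
      then have "2 * real (card (hyperbola_sums N p)) \<le> real p + 1"
        by linarith
      moreover have "real p * (1 + 1 / real p) = real p + 1"
        using prime_gt_0_nat[OF pr[OF p]] by (simp add: distrib_left)
      ultimately show "real (card (hyperbola_sums N p)) \<le> real p * (1 + 1 / real p) / 2"
        by simp
    qed simp
    also have "\<dots> = real (\<Prod>P) / 2 ^ card P * (\<Prod>p\<in>P. 1 + 1 / real p)"
      by (simp add: prod.distrib prod_dividef)
    also have "\<dots> \<le> real (\<Prod>P) / 2 ^ card P * ((1 / ln 2 + 1) * ln B * exp 2)"
    proof (intro mult_left_mono)
      have "(\<Prod>p\<in>P. 1 + 1 / real p) \<le> (1 + ln B) * exp 2"
        using B by (intro prod_one_plus_inverse_prime_le) (auto simp: P_def)
      also have "1 + ln B \<le> (1 / ln 2 + 1) * ln B"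
        using B by (simp add: field_simps)
      finally show "(\<Prod>p\<in>P. 1 + 1 / real p) \<le> (1 / ln 2 + 1) * ln B * exp 2"
        by simp
    qed (rule divide_nonneg_nonneg; simp del: of_nat_prod)
    also have "\<dots> = C * (real (\<Prod>P) * ln B / 2 ^ prime_count B)"
      by (simp add: C_def \<pi> field_simps)
    finally show ?thesis by (simp add: Q)
  qed
  ultimately show ?thesis by blast
qed

end
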